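(* Let $p$ be a real number that is not an even integer (in particular $p\neq 0$). Then $$\int_0^1 \log\Gamma(x)\cos(p\pi x)\,dx = \left[\frac12\log(2\pi)-1\right]\frac{\sin(p\pi)}{p\pi}+\frac{Si(p\pi)}{p\pi}+\frac{2(1-\cos(p\pi))}{\pi^2}\sum_{n=1}^{\infty}\frac{Ci(2n\pi)}{4n^2-p^2}+\frac{p\sin(p\pi)}{\pi^2}\sum_{n=1}^{\infty}\frac1n\,\frac{si(2n\pi)}{4n^2-p^2}.$$
   Context: $\Gamma$ is the gamma function and $\log$ is the natural logarithm. The sine and cosine integrals are defined by $$Si(x)=\int_0^x\frac{\sin t}{t}\,dt,\qquad si(x)=-\int_x^\infty\frac{\sin t}{t}\,dt=Si(x)-\frac{\pi}{2},$$ and, for $x>0$, $$Ci(x)=-\int_x^\infty\frac{\cos t}{t}\,dt=\gamma+\log x+\int_0^x\frac{\cos t-1}{t}\,dt,$$ where $\gamma$ is Euler's constant. *)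

theory Defs
  imports "HOL-Probability.Sinc_Integral"
begin

text \<open>
  The sine integral \<^const>\<open>Si\<close> is the library's, an oriented integral, so that
  it is the intended odd function on negative arguments as well.

  The two integrals below converge only conditionally, hence do not exist in the Lebesgue
  sense. The Henstock--Kurzweil integral over the ray \<open>{x..}\<close> is the improper
  integral \<open>lim T \<rightarrow> \<infinity>\<close> of the integrals over \<open>{x..T}\<close>.
\<close>

definition si :: "real \<Rightarrow> real" where
  "si x = - integral {x..} (\<lambda>t. sin t / t)"

text \<open>Meaningful for \<open>x > 0\<close> only.\<close>

definition Ci :: "real \<Rightarrow> real" where
  "Ci x = - integral {x..} (\<lambda>t. cos t / t)"

end

theory Submission
  imports Defs "HOL-Real_Asymp.Real_Asymp"
begin

text \<open>
  The functional equation splits \<open>ln (Gamma x) = ln_Gamma (1 + x) - ln x\<close>. The term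
  \<open>- ln x\<close> carries the singularity at \<open>0\<close>, and its integral against
  \<open>cos (p \<pi> x)\<close> is \<open>Si (p \<pi>) / (p \<pi>)\<close> by an explicit antiderivative
  (\<open>has_integral_ln_cos\<close>).

  The remaining function \<open>F x = ln_Gamma (1 + x)\<close> is smooth on \<open>[0,1]\<close> and vanishes at both
  end points, hence is a continuous periodic function. All the special values in the formula are its
  Fourier coefficients: its mean is \<open>ln (2 \<pi>) / 2 - 1\<close>, and
  \<open>\<integral> F x cos (2 \<pi> n x) = - si (2 \<pi> n) / (2 \<pi> n)\<close>,
  \<open>\<integral> F x sin (2 \<pi> n x) = Ci (2 \<pi> n) / (2 \<pi> n)\<close>.
  For the mean, the duplication formula of the gamma function yields a linear equation
  (\<open>integral_ln_Gamma_shift\<close>). For the others, integration by parts replaces \<open>F\<close> by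
  \<open>Digamma (1 + x)\<close>, which is a regularised sum of \<open>- 1 / (x + k)\<close> over \<open>k \<ge> 1\<close>. Since
  the weights have period \<open>1\<close>, the integrals over the unit interval join into one improper
  integral of \<open>- sin t / t\<close> or \<open>- cos t / t\<close> over a ray
  (\<open>has_integral_oscillating_over_ray\<close>).

  The coefficients are \<open>O(1 / n\<^sup>2)\<close>, so the Fourier series of \<open>F\<close> converges absolutely and
  represents \<open>F\<close>; it may be integrated term by term against \<open>cos (p \<pi> x)\<close>
  (\<open>fourier_series_sums_integral\<close>). The elementary integrals
  \<open>integral_trig_2pi_nat_times_cos\<close> supply the factors \<open>1 / (4 n\<^sup>2 - p\<^sup>2)\<close>. That the Fourier
  series represents the function rests on the uniqueness statement \<open>fourier_null_imp_zero\<close>,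
  a consequence of the theorem of Stone and Weierstrass on the circle.
\<close>

section \<open>Uniqueness of Fourier coefficients\<close>

text \<open>
  Testing against all integer frequencies, negative ones included, makes the condition invariant
  under frequency shifts, so that the product formulas below need no case distinction at
  frequency \<open>0\<close>.
\<close>

definition fourier_null :: "(real \<Rightarrow> real) \<Rightarrow> bool" where
  "fourier_null h \<longleftrightarrow> continuous_on {0..1} h \<and>
     (\<forall>k::int. ((\<lambda>x. h x * cos (2 * pi * of_int k * x)) has_integral 0) {0..1} \<and>
               ((\<lambda>x. h x * sin (2 * pi * of_int k * x)) has_integral 0) {0..1})"

lemma fourier_null_linear:
  assumes "fourier_null f" "fourier_null g"
  shows "fourier_null (\<lambda>x. a * f x + b * g x)"
proof -
  have "((\<lambda>x. (a * f x + b * g x) * cos (2 * pi * of_int k * x)) has_integral 0) {0..1}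
      \<and> ((\<lambda>x. (a * f x + b * g x) * sin (2 * pi * of_int k * x)) has_integral 0) {0..1}" for k :: int
  proof -
    have *: "((\<lambda>x. (a * f x + b * g x) * w x) has_integral 0) {0..1}"
      if "((\<lambda>x. f x * w x) has_integral 0) {0..1}" "((\<lambda>x. g x * w x) has_integral 0) {0..1}" for w
      using has_integral_add[OF has_integral_mult_right[OF that(1), of a] has_integral_mult_right[OF that(2), of b]]
      by (simp add: algebra_simps)
    show ?thesis using assms unfolding fourier_null_def by (intro conjI *) auto
  qed
  moreover have "continuous_on {0..1} (\<lambda>x. a * f x + b * g x)"
    using assms unfolding fourier_null_def by (auto intro!: continuous_intros)
  ultimately show ?thesis unfolding fourier_null_def by blast
qed

text \<open>
  Multiplication by a trigonometric function of frequency \<open>1\<close> only shifts frequencies by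
  \<open>\<plusminus>1\<close>, by the product-to-sum formulas.
\<close>

lemma fourier_null_cos_sin:
  assumes "fourier_null h"
  shows "fourier_null (\<lambda>x. h x * cos (2 * pi * x))" "fourier_null (\<lambda>x. h x * sin (2 * pi * x))"
proof -
  have c: "((\<lambda>x. h x * cos (2 * pi * of_int k * x)) has_integral 0) {0..1}"
    and s: "((\<lambda>x. h x * sin (2 * pi * of_int k * x)) has_integral 0) {0..1}" for k :: int
    using assms unfolding fourier_null_def by blast+
  have avg: "((\<lambda>x. h x * w x) has_integral 0) {0..1}"
    if "((\<lambda>x. h x * u x) has_integral 0) {0..1}" "((\<lambda>x. h x * v x) has_integral 0) {0..1}"
       "\<And>x. w x = (u x + r * v x) / 2" for u v w r
    using has_integral_mult_right[OF has_integral_add[OF that(1) has_integral_mult_right[OF that(2), of r]], of "1/2"]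
    by (simp add: that(3) algebra_simps add_divide_distrib)
  have ang: "2 * pi * real_of_int (k + 1) * x = 2 * pi * of_int k * x + 2 * pi * x"
            "2 * pi * real_of_int (k - 1) * x = 2 * pi * of_int k * x - 2 * pi * x" for k x
    by (simp_all add: algebra_simps)
  have "((\<lambda>x. h x * (cos (2 * pi * x) * cos (2 * pi * of_int k * x))) has_integral 0) {0..1}" for k :: int
    by (rule avg[OF c[of "k + 1"] c[of "k - 1"], where r = 1]) (simp only: ang cos_add cos_diff, simp)
  moreover have "((\<lambda>x. h x * (cos (2 * pi * x) * sin (2 * pi * of_int k * x))) has_integral 0) {0..1}" for k :: int
    by (rule avg[OF s[of "k + 1"] s[of "k - 1"], where r = 1]) (simp only: ang sin_add sin_diff, simp)
  ultimately show "fourier_null (\<lambda>x. h x * cos (2 * pi * x))"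
    using assms unfolding fourier_null_def by (auto intro!: continuous_intros simp: mult.assoc)
  have "((\<lambda>x. h x * (sin (2 * pi * x) * cos (2 * pi * of_int k * x))) has_integral 0) {0..1}" for k :: int
    by (rule avg[OF s[of "k + 1"] s[of "k - 1"], where r = "-1"]) (simp only: ang sin_add sin_diff, simp)
  moreover have "((\<lambda>x. h x * (sin (2 * pi * x) * sin (2 * pi * of_int k * x))) has_integral 0) {0..1}" for k :: int
    by (rule avg[OF c[of "k - 1"] c[of "k + 1"], where r = "-1"]) (simp only: ang cos_add cos_diff, simp)
  ultimately show "fourier_null (\<lambda>x. h x * sin (2 * pi * x))"
    using assms unfolding fourier_null_def by (auto intro!: continuous_intros simp: mult.assoc)
qed

text \<open>
  On the unit circle a linear functional is a combination of \<open>cos\<close> and \<open>sin\<close>; products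
  and sums are then handled by applying the closure properties repeatedly. This avoids writing a
  polynomial in \<open>cos\<close> and \<open>sin\<close> as an explicit trigonometric sum.
\<close>

lemma fourier_null_real_polynomial:
  fixes P :: "complex \<Rightarrow> real"
  assumes "real_polynomial_function P" "fourier_null h"
  shows "fourier_null (\<lambda>x. h x * P (cis (2 * pi * x)))"
  using assms
proof (induction arbitrary: h rule: real_polynomial_function.induct)
  case (linear f)
  note null = linear.prems
  interpret bounded_linear f by (rule linear.hyps)
  have "f (cis t) = cos t * f 1 + sin t * f \<i>" for t
  proof -
    have "cis t = cos t *\<^sub>R 1 + sin t *\<^sub>R \<i>" by (simp add: complex_eq_iff)
    thus ?thesis by (metis add scaleR real_scaleR_def)
  qed
  thus ?case using fourier_null_linear[OF fourier_null_cos_sin[OF null], of "f 1" "f \<i>"]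
    by (simp add: algebra_simps)
next
  case (const c)
  thus ?case using fourier_null_linear[OF const const, of c 0] by (simp add: algebra_simps)
next
  case (add f g)
  thus ?case using fourier_null_linear[OF add.IH(1)[OF add.prems] add.IH(2)[OF add.prems], of 1 1]
    by (simp add: algebra_simps)
next
  case (mult f g)
  thus ?case using mult.IH(2)[OF mult.IH(1)[OF mult.prems]] by (simp add: algebra_simps)
qed

text \<open>
  Because \<open>h 0 = h 1\<close>, the function \<open>h\<close> is a loop and descends to a continuous
  function on the unit circle, where the theorem of Stone and Weierstrass applies. The continuity of
  the descended function is read off from the correspondence between loops and maps of the circle,
  applied to the constant homotopy.
\<close>

lemma periodic_trig_approximation:
  fixes h :: "real \<Rightarrow> real"
  assumes h: "continuous_on {0..1} h" "h 0 = h 1" and "e > 0"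
  obtains P :: "complex \<Rightarrow> real"
  where "real_polynomial_function P" "\<And>x. x \<in> {0..1} \<Longrightarrow> \<bar>h x - P (cis (2 * pi * x))\<bar> < e"
proof -
  have "homotopic_loops UNIV h h"
    using h by (simp add: homotopic_loops_refl path_def pathstart_def pathfinish_def)
  then have "continuous_on (sphere 0 1) (h \<circ> (\<lambda>z. Arg2pi z / (2 * pi)))"
    using homotopic_loops_imp_homotopic_circlemaps homotopic_with_imp_continuous by blast
  then obtain P :: "complex \<Rightarrow> real" where P: "real_polynomial_function P"
    "\<And>z. z \<in> sphere 0 1 \<Longrightarrow> \<bar>(h \<circ> (\<lambda>z. Arg2pi z / (2 * pi))) z - P z\<bar> < e"
    using Stone_Weierstrass_real_polynomial_function[of "sphere 0 1"] \<open>e > 0\<close> compact_sphere by metis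
  have "\<bar>h x - P (cis (2 * pi * x))\<bar> < e" if "x \<in> {0..1}" for x
  proof (cases "x = 1")
    case True
    have "Arg2pi (1::complex) = 0" using Arg2pi_of_real[of 1] by simp
    thus ?thesis using P(2)[of 1] h(2) True by simp
  next
    case False
    with that have "Arg2pi (cis (2 * pi * x)) = 2 * pi * x"
      by (intro Arg2pi_unique[of 1]) (auto simp: cis_conv_exp)
    thus ?thesis using P(2)[of "cis (2 * pi * x)"] by simp
  qed
  with P(1) show ?thesis using that by blast
qed

text \<open>
  A null function is orthogonal to all trigonometric polynomials, and these come uniformly close to
  the function itself; hence the integral of its square is smaller than any multiple of the
  approximation error.
\<close>

lemma fourier_null_imp_zero:
  assumes h: "fourier_null h" "h 0 = h 1" and x: "x \<in> {0..1}"
  shows "h x = 0"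
proof -
  have cont: "continuous_on {0..1} h" using h(1) unfolding fourier_null_def by blast
  then obtain B where B: "\<And>x. x \<in> {0..1} \<Longrightarrow> \<bar>h x\<bar> \<le> B"
    using compact_continuous_image[OF cont] compact_imp_bounded bounded_iff
    by (metis (no_types, lifting) compact_Icc imageI real_norm_def)
  have B0: "B \<ge> 0" using B[of 0] by simp
  have i2: "(\<lambda>x. h x * h x) integrable_on {0..1}"
    using cont by (intro integrable_continuous_real continuous_intros)
  have small: "\<bar>integral {0..1} (\<lambda>x. h x * h x)\<bar> \<le> B * e" if e: "e > 0" for e
  proof -
    obtain P :: "complex \<Rightarrow> real" where P: "real_polynomial_function P"
      "\<And>x. x \<in> {0..1} \<Longrightarrow> \<bar>h x - P (cis (2 * pi * x))\<bar> < e"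
      using periodic_trig_approximation[OF cont h(2) e] by blast
    have "fourier_null (\<lambda>x. h x * P (cis (2 * pi * x)))"
      by (rule fourier_null_real_polynomial[OF P(1) h(1)])
    then have "((\<lambda>x. (h x * P (cis (2 * pi * x))) * cos (2 * pi * of_int 0 * x)) has_integral 0) {0..1}"
      unfolding fourier_null_def by blast
    then have z: "((\<lambda>x. h x * P (cis (2 * pi * x))) has_integral 0) {0..1}" by simp
    from has_integral_diff[OF integrable_integral[OF i2] z]
    have *: "((\<lambda>x. h x * (h x - P (cis (2 * pi * x)))) has_integral integral {0..1} (\<lambda>x. h x * h x)) {0..1}"
      by (simp add: algebra_simps)
    have "norm (integral {0..1} (\<lambda>x. h x * h x)) \<le> B * e * Henstock_Kurzweil_Integration.content (cbox 0 (1::real))"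
    proof (rule has_integral_bound)
      show "((\<lambda>x. h x * (h x - P (cis (2 * pi * x)))) has_integral integral {0..1} (\<lambda>x. h x * h x)) (cbox 0 1)"
        using * by simp
      show "norm (h x * (h x - P (cis (2 * pi * x)))) \<le> B * e" if "x \<in> cbox 0 1" for x
        using that B[of x] P(2)[of x] B0 e by (auto simp: abs_mult intro!: mult_mono)
    qed (use B0 e in auto)
    thus ?thesis by simp
  qed
  have "integral {0..1} (\<lambda>x. h x * h x) = 0"
  proof (rule ccontr)
    assume n: "integral {0..1} (\<lambda>x. h x * h x) \<noteq> 0" (is "?I \<noteq> 0")
    have "\<bar>?I\<bar> \<le> B * (\<bar>?I\<bar> / (2 * (B + 1)))" using n B0 by (intro small) auto
    also have "\<dots> < \<bar>?I\<bar>" using n B0 by (simp add: field_simps add_nonneg_pos)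
    finally show False by simp
  qed
  then have "\<forall>x\<in>{0..1}. h x * h x = 0"
    using integral_eq_0_iff[OF continuous_on_mult[OF cont cont]] by simp
  thus ?thesis using x by simp
qed

section \<open>Absolutely convergent Fourier series\<close>

lemma has_integral_cos_Icc01:
  "((\<lambda>x. cos (c * x)) has_integral (if c = 0 then 1 else sin c / c)) {0..1::real}"
proof (cases "c = 0")
  case True
  thus ?thesis using has_integral_const_real[of "1::real" 0 1] by simp
next
  case False
  have "((\<lambda>x. cos (c * x)) has_integral (sin (c * 1) / c - sin (c * 0) / c)) {0..1}"
    using False by (intro fundamental_theorem_of_calculus)
      (auto intro!: derivative_eq_intros simp: has_real_derivative_iff_has_vector_derivative[symmetric])
  thus ?thesis using False by simp
qed

lemma has_integral_sin_Icc01: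
  "((\<lambda>x. sin (c * x)) has_integral (if c = 0 then 0 else (1 - cos c) / c)) {0..1::real}"
proof (cases "c = 0")
  case True
  thus ?thesis by simp
next
  case False
  have "((\<lambda>x. sin (c * x)) has_integral (- cos (c * 1) / c - - cos (c * 0) / c)) {0..1}"
    using False by (intro fundamental_theorem_of_calculus)
      (auto intro!: derivative_eq_intros simp: has_real_derivative_iff_has_vector_derivative[symmetric])
  thus ?thesis using False by (simp add: diff_divide_distrib)
qed

lemma sin_cos_2pi_int [simp]:
  "sin (2 * pi * of_int k) = (0::real)" "cos (2 * pi * of_int k) = (1::real)"
  using sin_int_2pin[of k] cos_int_2pin[of k] by (simp_all add: mult_ac)

lemma has_integral_trig_int:
  "((\<lambda>x. cos (2 * pi * of_int k * x)) has_integral (if k = 0 then 1 else 0)) {0..1}"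
  "((\<lambda>x. sin (2 * pi * of_int k * x)) has_integral 0) {0..1}"
  using has_integral_cos_Icc01[of "2 * pi * of_int k"] has_integral_sin_Icc01[of "2 * pi * of_int k"]
  by (auto split: if_splits)

lemma has_integral_trig_products:
  fixes k j :: int
  shows "((\<lambda>x. cos (2 * pi * of_int k * x) * cos (2 * pi * of_int j * x)) has_integral
           (of_bool (k + j = 0) + of_bool (k - j = 0)) / 2) {0..1}"
    and "((\<lambda>x. sin (2 * pi * of_int k * x) * sin (2 * pi * of_int j * x)) has_integral
           (of_bool (k - j = 0) - of_bool (k + j = 0)) / 2) {0..1}"
    and "((\<lambda>x. sin (2 * pi * of_int k * x) * cos (2 * pi * of_int j * x)) has_integral 0) {0..1}"
proof -
  note c = has_integral_trig_int(1) and s = has_integral_trig_int(2)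
  have ang: "2 * pi * real_of_int (k + j) * x = 2 * pi * of_int k * x + 2 * pi * of_int j * x"
            "2 * pi * real_of_int (k - j) * x = 2 * pi * of_int k * x - 2 * pi * of_int j * x" for x
    by (simp_all add: algebra_simps)
  note pos = ang cos_add cos_diff sin_add sin_diff
  show "((\<lambda>x. cos (2 * pi * of_int k * x) * cos (2 * pi * of_int j * x)) has_integral
           (of_bool (k + j = 0) + of_bool (k - j = 0)) / 2) {0..1}"
    using has_integral_mult_right[OF has_integral_add[OF c[of "k + j"] c[of "k - j"]], of "1/2"]
    unfolding pos by (simp add: of_bool_def mult.commute split: if_splits)
  show "((\<lambda>x. sin (2 * pi * of_int k * x) * sin (2 * pi * of_int j * x)) has_integral
           (of_bool (k - j = 0) - of_bool (k + j = 0)) / 2) {0..1}"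
    using has_integral_mult_right[OF has_integral_diff[OF c[of "k - j"] c[of "k + j"]], of "1/2"]
    unfolding pos by (simp add: of_bool_def mult.commute split: if_splits)
  show "((\<lambda>x. sin (2 * pi * of_int k * x) * cos (2 * pi * of_int j * x)) has_integral 0) {0..1}"
    using has_integral_mult_right[OF has_integral_add[OF s[of "k + j"] s[of "k - j"]], of "1/2"]
    unfolding pos by (simp add: mult.commute)
qed

text \<open>
  The series with the Fourier coefficients of \<open>f\<close> converges uniformly, so that its sum is
  continuous and has, by termwise integration, the same coefficients as \<open>f\<close>. By uniqueness it is
  \<open>f\<close>. The conclusion is stated in integrated form: it gives \<open>\<integral> f g\<close> for any weight
  \<open>g\<close> without naming the series, and \<open>g\<close> may take different values at the end points.
\<close>

theorem fourier_series_sums_integral: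
  fixes f g :: "real \<Rightarrow> real" and a b :: "nat \<Rightarrow> real"
  assumes f: "continuous_on {0..1} f" "f 0 = f 1" and g: "continuous_on {0..1} g"
    and a0: "(f has_integral a0) {0..1}"
    and a: "\<And>n. ((\<lambda>x. f x * cos (2 * pi * real (Suc n) * x)) has_integral a n) {0..1}"
    and b: "\<And>n. ((\<lambda>x. f x * sin (2 * pi * real (Suc n) * x)) has_integral b n) {0..1}"
    and sa: "summable (\<lambda>n. \<bar>a n\<bar>)" and sb: "summable (\<lambda>n. \<bar>b n\<bar>)"
  shows "(\<lambda>n. 2 * (a n * integral {0..1} (\<lambda>x. cos (2 * pi * real (Suc n) * x) * g x)
                 + b n * integral {0..1} (\<lambda>x. sin (2 * pi * real (Suc n) * x) * g x)))
          sums (integral {0..1} (\<lambda>x. f x * g x) - a0 * integral {0..1} g)"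
proof -
  define t where "t n x = 2 * (a n * cos (2 * pi * real (Suc n) * x)
                             + b n * sin (2 * pi * real (Suc n) * x))" for n x
  define T where "T x = (\<Sum>n. t n x)" for x
  have t_bound: "\<bar>t n x\<bar> \<le> 2 * (\<bar>a n\<bar> + \<bar>b n\<bar>)" for n x
  proof -
    have "\<bar>a n * cos (2 * pi * real (Suc n) * x) + b n * sin (2 * pi * real (Suc n) * x)\<bar>
        \<le> \<bar>a n\<bar> * 1 + \<bar>b n\<bar> * 1"
      by (rule order_trans[OF abs_triangle_ineq], unfold abs_mult, intro add_mono mult_left_mono) simp_all
    thus ?thesis by (simp add: t_def abs_mult)
  qed
  have sab: "summable (\<lambda>n. 2 * (\<bar>a n\<bar> + \<bar>b n\<bar>))"
    by (intro summable_mult summable_add sa sb)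
  have t_sums: "summable (\<lambda>n. t n x)" for x
    by (rule summable_comparison_test[OF _ sab]) (use t_bound in auto)
  have t_cont: "continuous_on {0..1} (t n)" for n
    unfolding t_def by (intro continuous_intros)
  have T_cont: "continuous_on {0..1} T"
  proof (rule uniform_limit_theorem)
    show "uniform_limit {0..1} (\<lambda>n x. \<Sum>i<n. t i x) T sequentially"
      unfolding T_def by (rule Weierstrass_m_test[OF _ sab]) (use t_bound in auto)
  qed (auto intro!: always_eventually continuous_intros t_cont)
  \<comment> \<open>absolute convergence lets the series be integrated term by term against any continuous weight\<close>
  have termwise: "(\<lambda>n. integral {0..1} (\<lambda>x. t n x * w x)) sums integral {0..1} (\<lambda>x. T x * w x)"
    if w: "continuous_on {0..1} w" for w :: "real \<Rightarrow> real"
  proof -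
    obtain W where W: "\<And>x. x \<in> {0..1} \<Longrightarrow> \<bar>w x\<bar> \<le> W"
      using compact_continuous_image[OF w] compact_imp_bounded bounded_iff
      by (metis (no_types, lifting) compact_Icc imageI real_norm_def)
    have u: "uniform_limit {0..1} (\<lambda>n x. \<Sum>i<n. t i x * w x) (\<lambda>x. \<Sum>i. t i x * w x) sequentially"
    proof (rule Weierstrass_m_test[OF _ summable_mult2[OF sab, of W]])
      fix n x assume "x \<in> {0..1::real}"
      thus "norm (t n x * w x) \<le> 2 * (\<bar>a n\<bar> + \<bar>b n\<bar>) * W"
        using t_bound[of n x] W[of x] by (simp only: real_norm_def abs_mult) (intro mult_mono, auto)
    qed
    have eq: "(\<lambda>x. \<Sum>i. t i x * w x) = (\<lambda>x. T x * w x)"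
      unfolding T_def using t_sums by (simp add: suminf_mult2)
    have c: "continuous_on {0..1} (\<lambda>x. \<Sum>i<n. t i x * w x)" for n
      by (intro continuous_intros t_cont w)
    obtain I J where I: "\<And>n. ((\<lambda>x. \<Sum>i<n. t i x * w x) has_integral I n) {0..1}"
      and J: "((\<lambda>x. \<Sum>i. t i x * w x) has_integral J) {0..1}" and lim: "I \<longlonglongrightarrow> J"
      using uniform_limit_integral[OF u c] by auto
    have "I = (\<lambda>n. \<Sum>i<n. integral {0..1} (\<lambda>x. t i x * w x))"
    proof
      fix n
      have "integral {0..1} (\<lambda>x. \<Sum>i<n. t i x * w x) = (\<Sum>i<n. integral {0..1} (\<lambda>x. t i x * w x))"
        by (intro integral_sum integrable_continuous_real continuous_intros t_cont w) auto
      thus "I n = (\<Sum>i<n. integral {0..1} (\<lambda>x. t i x * w x))"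
        using I[of n] by (simp add: integral_unique)
    qed
    moreover have "J = integral {0..1} (\<lambda>x. T x * w x)"
      using J by (simp add: eq integral_unique)
    ultimately show ?thesis using lim by (simp add: sums_def)
  qed
  define h where "h x = f x - a0 - T x" for x
  have h_cont: "continuous_on {0..1} h"
    unfolding h_def by (intro continuous_intros f T_cont)
  have h01: "h 0 = h 1"
  proof -
    have "t n 0 = t n 1" for n
      using sin_cos_2pi_int[of "int (Suc n)"] by (simp add: t_def)
    thus ?thesis unfolding h_def T_def using f(2) by simp
  qed
  have h_split: "((\<lambda>x. h x * w x) has_integral I - a0 * J - L) {0..1}"
    if "((\<lambda>x. f x * w x) has_integral I) {0..1}" "(w has_integral J) {0..1}"
       "(\<lambda>n. integral {0..1} (\<lambda>x. t n x * w x)) sums L" "continuous_on {0..1} w" for w I J L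
  proof -
    have "L = integral {0..1} (\<lambda>x. T x * w x)"
      using sums_unique2[OF that(3) termwise[OF that(4)]] .
    moreover have "(\<lambda>x. T x * w x) integrable_on {0..1}"
      by (intro integrable_continuous_real continuous_intros T_cont that)
    ultimately have L: "((\<lambda>x. T x * w x) has_integral L) {0..1}" by blast
    show ?thesis
      using has_integral_diff[OF has_integral_diff[OF that(1) has_integral_mult_right[OF that(2), of a0]] L]
      by (simp add: h_def algebra_simps)
  qed
  have null_nat: "((\<lambda>x. h x * cos (2 * pi * of_int (int j) * x)) has_integral 0) {0..1}
             \<and> ((\<lambda>x. h x * sin (2 * pi * of_int (int j) * x)) has_integral 0) {0..1}" for j :: nat
  proof -
    have tc: "integral {0..1} (\<lambda>x. t n x * cos (2 * pi * of_int (int j) * x)) = (if n + 1 = j then a n else 0)" for n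
    proof -
      have "(\<lambda>x. t n x * cos (2 * pi * of_int (int j) * x))
        = (\<lambda>x. 2 * (a n * (cos (2 * pi * of_int (int (Suc n)) * x) * cos (2 * pi * of_int (int j) * x))
                + b n * (sin (2 * pi * of_int (int (Suc n)) * x) * cos (2 * pi * of_int (int j) * x))))"
        by (simp add: t_def algebra_simps fun_eq_iff)
      thus ?thesis
        using integral_unique[OF has_integral_mult_right[OF has_integral_add[OF
          has_integral_mult_right[OF has_integral_trig_products(1)[of "int (Suc n)" "int j"], of "a n"]
          has_integral_mult_right[OF has_integral_trig_products(3)[of "int (Suc n)" "int j"], of "b n"]], of 2]]
        by auto
    qed
    have ts: "integral {0..1} (\<lambda>x. t n x * sin (2 * pi * of_int (int j) * x)) = (if n + 1 = j then b n else 0)" for n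
    proof -
      have "(\<lambda>x. t n x * sin (2 * pi * of_int (int j) * x))
        = (\<lambda>x. 2 * (a n * (sin (2 * pi * of_int (int j) * x) * cos (2 * pi * of_int (int (Suc n)) * x))
                + b n * (sin (2 * pi * of_int (int (Suc n)) * x) * sin (2 * pi * of_int (int j) * x))))"
        by (simp add: t_def algebra_simps fun_eq_iff)
      thus ?thesis
        using integral_unique[OF has_integral_mult_right[OF has_integral_add[OF
          has_integral_mult_right[OF has_integral_trig_products(3)[of "int j" "int (Suc n)"], of "a n"]
          has_integral_mult_right[OF has_integral_trig_products(2)[of "int (Suc n)" "int j"], of "b n"]], of 2]]
        by auto
    qed
    show ?thesis
    proof (cases j)
      case 0
      have "((\<lambda>x. h x * cos (2 * pi * of_int (int 0) * x)) has_integral a0 - a0 * 1 - 0) {0..1}"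
      proof (rule h_split)
        show "((\<lambda>x. f x * cos (2 * pi * of_int (int 0) * x)) has_integral a0) {0..1}"
          using a0 by simp
        show "((\<lambda>x. cos (2 * pi * of_int (int 0) * x)) has_integral 1) {0..1}"
          using has_integral_trig_int(1)[of 0] by simp
        show "(\<lambda>n. integral {0..1} (\<lambda>x. t n x * cos (2 * pi * of_int (int 0) * x))) sums 0"
          using tc unfolding 0 by simp
      qed (auto intro!: continuous_intros)
      thus ?thesis using 0 by simp
    next
      case (Suc m)
      have "((\<lambda>x. h x * cos (2 * pi * of_int (int j) * x)) has_integral a m - a0 * 0 - a m) {0..1}"
      proof (rule h_split)
        show "((\<lambda>x. f x * cos (2 * pi * of_int (int j) * x)) has_integral a m) {0..1}"
          using a[of m] Suc by simp
        show "((\<lambda>x. cos (2 * pi * of_int (int j) * x)) has_integral 0) {0..1}"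
          using has_integral_trig_int(1)[of "int j"] Suc by simp
        show "(\<lambda>n. integral {0..1} (\<lambda>x. t n x * cos (2 * pi * of_int (int j) * x))) sums a m"
          unfolding tc using sums_single[of m a] Suc by simp
      qed (auto intro!: continuous_intros)
      moreover have "((\<lambda>x. h x * sin (2 * pi * of_int (int j) * x)) has_integral b m - a0 * 0 - b m) {0..1}"
      proof (rule h_split)
        show "((\<lambda>x. f x * sin (2 * pi * of_int (int j) * x)) has_integral b m) {0..1}"
          using b[of m] Suc by simp
        show "((\<lambda>x. sin (2 * pi * of_int (int j) * x)) has_integral 0) {0..1}"
          by (rule has_integral_trig_int(2))
        show "(\<lambda>n. integral {0..1} (\<lambda>x. t n x * sin (2 * pi * of_int (int j) * x))) sums b m"
          unfolding ts using sums_single[of m b] Suc by simp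
      qed (auto intro!: continuous_intros)
      ultimately show ?thesis by simp
    qed
  qed
  have "((\<lambda>x. h x * cos (2 * pi * of_int k * x)) has_integral 0) {0..1}
      \<and> ((\<lambda>x. h x * sin (2 * pi * of_int k * x)) has_integral 0) {0..1}" for k :: int
  proof (cases k)
    case (nonneg j)
    thus ?thesis using null_nat[of j] by simp
  next
    case (neg j)
    have "((\<lambda>x. - (h x * sin (2 * pi * of_int (int (Suc j)) * x))) has_integral - 0) {0..1}"
      using null_nat[of "Suc j"] by (intro has_integral_neg) blast
    moreover have e: "2 * pi * of_int k * x = - (2 * pi * of_int (int (Suc j)) * x)" for x
      by (simp only: neg of_int_minus mult_minus_right mult_minus_left)
    ultimately show ?thesis
      unfolding e cos_minus sin_minus mult_minus_right using null_nat[of "Suc j"] by (simp only: minus_zero)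
  qed
  with h_cont have "fourier_null h" unfolding fourier_null_def by blast
  then have fT: "f x = a0 + T x" if "x \<in> {0..1}" for x
    using fourier_null_imp_zero[OF _ h01 that] h_def[of x] by simp
  have "integral {0..1} (\<lambda>x. f x * g x) = integral {0..1} (\<lambda>x. a0 * g x + T x * g x)"
    by (rule integral_cong) (simp add: fT algebra_simps)
  also have "\<dots> = a0 * integral {0..1} g + integral {0..1} (\<lambda>x. T x * g x)"
    by (subst integral_add) (auto intro!: integrable_continuous_real continuous_intros g T_cont)
  finally have "integral {0..1} (\<lambda>x. f x * g x) - a0 * integral {0..1} g = integral {0..1} (\<lambda>x. T x * g x)"
    by simp
  moreover have "integral {0..1} (\<lambda>x. t n x * g x) =
      2 * (a n * integral {0..1} (\<lambda>x. cos (2 * pi * real (Suc n) * x) * g x)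
         + b n * integral {0..1} (\<lambda>x. sin (2 * pi * real (Suc n) * x) * g x))" (is "_ = ?rhs") for n
  proof -
    have "integral {0..1} (\<lambda>x. t n x * g x) =
      integral {0..1} (\<lambda>x. 2 * (a n * (cos (2 * pi * real (Suc n) * x) * g x)
                              + b n * (sin (2 * pi * real (Suc n) * x) * g x)))"
      by (rule integral_cong) (simp add: t_def algebra_simps)
    also have "\<dots> = 2 * integral {0..1} (\<lambda>x. a n * (cos (2 * pi * real (Suc n) * x) * g x)
                              + b n * (sin (2 * pi * real (Suc n) * x) * g x))"
      by (rule integral_mult_right)
    also have "integral {0..1} (\<lambda>x. a n * (cos (2 * pi * real (Suc n) * x) * g x)
                              + b n * (sin (2 * pi * real (Suc n) * x) * g x))
       = integral {0..1} (\<lambda>x. a n * (cos (2 * pi * real (Suc n) * x) * g x))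
       + integral {0..1} (\<lambda>x. b n * (sin (2 * pi * real (Suc n) * x) * g x))"
      by (rule integral_add; intro integrable_continuous_real continuous_intros g)
    finally show ?thesis by simp
  qed
  ultimately show ?thesis using termwise[OF g] by simp
qed

section \<open>The digamma function and oscillating integrals over rays\<close>

text \<open>
  A box around a large enough ball meets the ray in some \<open>{a..d}\<close> with \<open>d\<close> large, so for the
  gauge integral convergence of the truncations already gives the integral over the ray, without
  absolute convergence.
\<close>

lemma has_integral_atLeast_of_tendsto:
  fixes f :: "real \<Rightarrow> real"
  assumes int: "\<And>b. b \<ge> a \<Longrightarrow> f integrable_on {a..b}"
    and lim: "((\<lambda>b. integral {a..b} f) \<longlongrightarrow> L) at_top"
  shows "(f has_integral L) {a..}"
  unfolding has_integral_alt'
proof safe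
  fix c d :: real
  have "f integrable_on {max a c..d}"
    using integrable_on_subinterval[OF int[of "max a d"], of "max a c" d] by auto
  moreover have "{a..} \<inter> cbox c d = {max a c..d}" by auto
  ultimately show "(\<lambda>x. if x \<in> {a..} then f x else 0) integrable_on cbox c d"
    by (simp only: integrable_restrict_Int)
next
  fix e :: real assume "e > 0"
  then have "\<forall>\<^sub>F b in at_top. \<bar>integral {a..b} f - L\<bar> < e"
    using tendstoD[OF lim] by (simp add: dist_real_def)
  then obtain B where B: "\<And>b. b \<ge> B \<Longrightarrow> \<bar>integral {a..b} f - L\<bar> < e"
    unfolding eventually_at_top_linorder by blast
  show "\<exists>B>0. \<forall>c d. ball 0 B \<subseteq> cbox c d \<longrightarrow>
      norm (integral (cbox c d) (\<lambda>x. if x \<in> {a..} then f x else 0) - L) < e"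
  proof (intro exI conjI allI impI)
    show "max 1 (max \<bar>a\<bar> B) > 0" by simp
    fix c d :: real assume sub: "ball 0 (max 1 (max \<bar>a\<bar> B)) \<subseteq> cbox c d"
    define M where "M = max 1 (max \<bar>a\<bar> B)"
    have "M > 0" and M: "\<bar>a\<bar> \<le> M" "B \<le> M" by (simp_all add: M_def)
    have "closure (ball 0 M) \<subseteq> cbox c d"
      using sub unfolding M_def by (intro closure_minimal) auto
    then have "cball 0 M \<subseteq> cbox c d" using \<open>M > 0\<close> by simp
    then have "- M \<in> cbox c d" "M \<in> cbox c d" using \<open>M > 0\<close> by (auto simp: subset_iff)
    then have cd: "c \<le> a" "d \<ge> B" using M by auto
    then have "{a..} \<inter> cbox c d = {a..d}" by auto
    then have "integral (cbox c d) (\<lambda>x. if x \<in> {a..} then f x else 0) = integral {a..d} f"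
      by (simp only: integral_restrict_Int)
    thus "norm (integral (cbox c d) (\<lambda>x. if x \<in> {a..} then f x else 0) - L) < e"
      using B[OF cd(2)] by simp
  qed
qed

text \<open>
  Gauss's limit writes \<open>Digamma (1 + x)\<close> as the limit of
  \<open>ln m - (\<Sum>k<m. 1 / (k + 1 + x))\<close>. Against a periodic weight of mean zero the
  logarithm contributes nothing, and the integral of the \<open>k\<close>-th summand over the unit interval
  becomes the integral of \<open>w t / t\<close> over the \<open>k\<close>-th translate of that interval.
\<close>

lemma Digamma_unfold_limit:
  fixes w :: "real \<Rightarrow> real"
  assumes w: "continuous_on UNIV w" and per: "\<And>x. w (x + 1) = w x"
    and mean: "(w has_integral 0) {0..1}"
  shows "(\<lambda>m. integral {1..real (Suc m)} (\<lambda>t. w t / t))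
           \<longlonglongrightarrow> - integral {0..1} (\<lambda>x. Digamma (1 + x) * w x)"
proof -
  have wS: "continuous_on S w" for S by (rule continuous_on_subset[OF w]) simp
  have per_nat: "w (x + real k) = w x" for x k
  proof (induction k)
    case (Suc k)
    thus ?case using per[of "x + real k"] by (simp add: add_ac)
  qed simp
  define D where "D m x = ln (real m) - (\<Sum>k<m. inverse (1 + x + real k))" for m :: nat and x :: real
  have D_lim: "(\<lambda>m. D m x) \<longlonglongrightarrow> Digamma (1 + x)" if "x \<ge> 0" for x
    using Digamma_LIMSEQ[of "1 + x"] that unfolding D_def by simp
  \<comment> \<open>each approximant increases with its argument, so the end points bound them all at once\<close>
  obtain K0 where K0: "\<And>m. \<bar>D m 0\<bar> \<le> K0"
    using convergent_imp_Bseq[OF convergentI[OF D_lim[of 0]]] by (auto simp: Bseq_def)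
  obtain K1 where K1: "\<And>m. \<bar>D m 1\<bar> \<le> K1"
    using convergent_imp_Bseq[OF convergentI[OF D_lim[of 1]]] by (auto simp: Bseq_def)
  have D_mono: "D m x \<le> D m y" if "0 \<le> x" "x \<le> y" for m x y
    unfolding D_def using that by (intro diff_left_mono sum_mono le_imp_inverse_le) auto
  have D_bound: "\<bar>D m x\<bar> \<le> max K0 K1" if "x \<in> {0..1}" for m x
    using D_mono[of 0 x m] D_mono[of x 1 m] K0[of m] K1[of m] that by (auto simp: abs_le_iff)
  obtain W where W: "\<And>x. x \<in> {0..1} \<Longrightarrow> \<bar>w x\<bar> \<le> W"
    using compact_continuous_image[OF wS] compact_imp_bounded bounded_iff
    by (metis (no_types, lifting) compact_Icc imageI real_norm_def)
  have D_cont: "continuous_on {0..1} (D m)" for m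
    unfolding D_def by (intro continuous_intros) auto
  have shift: "((\<lambda>x. inverse (1 + x + real k) * w x) has_integral
      integral {real (Suc k)..real (Suc (Suc k))} (\<lambda>t. w t / t)) {0..1}" for k
  proof -
    have "((\<lambda>x. 1 *\<^sub>R (w (x + real (Suc k)) / (x + real (Suc k)))) has_integral
        integral {0 + real (Suc k)..1 + real (Suc k)} (\<lambda>t. w t / t)) {0..1}"
      by (rule has_integral_substitution[where c = 1 and d = "real (Suc (Suc k))"])
         (auto intro!: continuous_intros wS derivative_eq_intros)
    moreover have "1 *\<^sub>R (w (x + real (Suc k)) / (x + real (Suc k))) = inverse (1 + x + real k) * w x" for x
      unfolding per_nat by (simp add: divide_inverse add_ac mult.commute)
    ultimately show ?thesis by (simp add: add_ac)
  qed
  have paste: "(\<Sum>k<m. integral {real (Suc k)..real (Suc (Suc k))} (\<lambda>t. w t / t))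
      = integral {1..real (Suc m)} (\<lambda>t. w t / t)" for m
  proof (induction m)
    case 0
    show ?case by simp
  next
    case (Suc m)
    have "(\<lambda>t. w t / t) integrable_on {1..real (Suc (Suc m))}"
      by (intro integrable_continuous_real continuous_intros wS) auto
    from Henstock_Kurzweil_Integration.integral_combine[OF _ _ this, of "real (Suc m)"] Suc
    show ?case by simp
  qed
  have "integral {0..1} (\<lambda>x. D m x * w x) = - integral {1..real (Suc m)} (\<lambda>t. w t / t)" for m
  proof -
    have "((\<lambda>x. ln (real m) * w x - (\<Sum>k<m. inverse (1 + x + real k) * w x)) has_integral
        ln (real m) * 0 - (\<Sum>k<m. integral {real (Suc k)..real (Suc (Suc k))} (\<lambda>t. w t / t))) {0..1}"
      by (intro has_integral_diff has_integral_mult_right mean has_integral_sum shift) auto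
    moreover have "(\<lambda>x. D m x * w x) = (\<lambda>x. ln (real m) * w x - (\<Sum>k<m. inverse (1 + x + real k) * w x))"
      unfolding D_def by (simp only: left_diff_distrib sum_distrib_right)
    ultimately show ?thesis unfolding paste by (simp add: integral_unique)
  qed
  moreover have "(\<lambda>m. integral {0..1} (\<lambda>x. D m x * w x))
      \<longlonglongrightarrow> integral {0..1} (\<lambda>x. Digamma (1 + x) * w x)"
  proof (rule dominated_convergence(2)[where h = "\<lambda>_. max K0 K1 * W"])
    show "(\<lambda>x. D m x * w x) integrable_on {0..1}" for m
      by (intro integrable_continuous_real continuous_intros D_cont wS)
    show "norm (D m x * w x) \<le> max K0 K1 * W" if "x \<in> {0..1}" for m x
      using D_bound[OF that, of m] W[OF that] by (simp only: real_norm_def abs_mult) (intro mult_mono, auto)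
    show "(\<lambda>m. D m x * w x) \<longlonglongrightarrow> Digamma (1 + x) * w x" if "x \<in> {0..1}" for x
      using that by (intro tendsto_mult_right D_lim) auto
  qed auto
  ultimately show ?thesis using tendsto_minus by fastforce
qed

text \<open>
  Between consecutive integers the integral of \<open>w t / t\<close> changes by at most the reciprocal of
  the smaller one, so convergence along the integers suffices.
\<close>

lemma Digamma_unfold_at_top:
  fixes w :: "real \<Rightarrow> real"
  assumes w: "continuous_on UNIV w" and per: "\<And>x. w (x + 1) = w x"
    and mean: "(w has_integral 0) {0..1}" and bound: "\<And>x. \<bar>w x\<bar> \<le> 1"
  shows "((\<lambda>T. integral {1..T} (\<lambda>t. w t / t))
           \<longlongrightarrow> - integral {0..1} (\<lambda>x. Digamma (1 + x) * w x)) at_top"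
proof -
  define G where "G T = integral {1..T} (\<lambda>t. w t / t)" for T
  define N where "N T = nat \<lfloor>T\<rfloor>" for T :: real
  have wS: "continuous_on S w" for S by (rule continuous_on_subset[OF w]) simp
  have N: "filterlim N sequentially at_top" unfolding N_def by real_asymp
  have "(\<lambda>n. G (real n)) \<longlonglongrightarrow> - integral {0..1} (\<lambda>x. Digamma (1 + x) * w x)"
    using LIMSEQ_imp_Suc[OF Digamma_unfold_limit[OF w per mean]] by (simp add: G_def)
  from filterlim_compose[OF this N]
  have 1: "((\<lambda>T. G (real (N T))) \<longlongrightarrow> - integral {0..1} (\<lambda>x. Digamma (1 + x) * w x)) at_top" .
  have "\<bar>G T - G (real (N T))\<bar> \<le> 1 / real (N T)" if "T \<ge> 1" for T
  proof -
    have "real (N T) = of_int \<lfloor>T\<rfloor>" using that by (simp add: N_def)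
    moreover have "1 \<le> \<lfloor>T\<rfloor>" using that by simp
    ultimately have N1: "1 \<le> real (N T)" "real (N T) \<le> T" "T - real (N T) \<le> 1"
      by (simp, simp, linarith)
    have "(\<lambda>t. w t / t) integrable_on {1..T}"
      by (intro integrable_continuous_real continuous_intros wS) auto
    from Henstock_Kurzweil_Integration.integral_combine[OF N1(1,2) this]
    have "G T - G (real (N T)) = integral {real (N T)..T} (\<lambda>t. w t / t)" by (simp add: G_def)
    moreover have "norm (integral {real (N T)..T} (\<lambda>t. w t / t)) \<le> 1 / real (N T) * (T - real (N T))"
    proof (rule integral_bound)
      show "continuous_on {real (N T)..T} (\<lambda>t. w t / t)"
        using N1 by (intro continuous_intros wS) auto
      show "norm (w t / t) \<le> 1 / real (N T)" if "t \<in> {real (N T)..T}" for t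
        using that N1 bound[of t] by (auto intro!: frac_le)
    qed (use N1 in auto)
    moreover have "1 / real (N T) * (T - real (N T)) \<le> 1 / real (N T) * 1"
      using N1 by (intro mult_left_mono) auto
    ultimately show ?thesis by simp
  qed
  then have "\<forall>\<^sub>F T in at_top. norm (G T - G (real (N T))) \<le> 1 / real (N T)"
    unfolding eventually_at_top_linorder by (intro exI[of _ 1]) simp
  moreover have "((\<lambda>T. 1 / real (N T)) \<longlongrightarrow> 0) at_top"
    by (rule filterlim_compose[OF lim_1_over_n N])
  ultimately have "((\<lambda>T. G T - G (real (N T))) \<longlongrightarrow> 0) at_top"
    by (rule Lim_null_comparison)
  from tendsto_add[OF this 1] show ?thesis by (simp add: G_def)
qed

text \<open>
  The substitution \<open>t = 2 \<pi> n u\<close> turns a weight of period \<open>2 \<pi>\<close> into one of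
  period \<open>1\<close>.
\<close>

lemma has_integral_oscillating_over_ray:
  fixes w :: "real \<Rightarrow> real" and n :: nat
  assumes w: "continuous_on UNIV w" and per: "\<And>x. w (x + 2 * pi) = w x"
    and bound: "\<And>x. \<bar>w x\<bar> \<le> 1" and n: "n > 0"
    and mean: "((\<lambda>x. w (2 * pi * real n * x)) has_integral 0) {0..1}"
  shows "((\<lambda>t. w t / t) has_integral - integral {0..1} (\<lambda>x. Digamma (1 + x) * w (2 * pi * real n * x)))
           {2 * pi * real n..}"
proof (rule has_integral_atLeast_of_tendsto)
  define a where "a = 2 * pi * real n"
  have a: "a > 0" using n by (simp add: a_def)
  have wS: "continuous_on S w" for S by (rule continuous_on_subset[OF w]) simp
  show "(\<lambda>t. w t / t) integrable_on {2 * pi * real n..b}" for b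
    using a unfolding a_def by (intro integrable_continuous_real continuous_intros wS) auto
  have per_nat: "w (x + 2 * pi * real k) = w x" for x k
  proof (induction k)
    case (Suc k)
    have "w (x + 2 * pi * real (Suc k)) = w (x + 2 * pi * real k + 2 * pi)"
      by (simp add: algebra_simps)
    thus ?case using per Suc by simp
  qed simp
  have per1: "w (a * (x + 1)) = w (a * x)" for x
    using per_nat[of "a * x" n] by (simp add: a_def algebra_simps)
  have scale: "integral {a..b} (\<lambda>t. w t / t) = integral {1..b / a} (\<lambda>u. w (a * u) / u)" if "b \<ge> a" for b
  proof -
    have "((\<lambda>u. a *\<^sub>R (w (a * u) / (a * u))) has_integral
        integral {a * 1..a * (b / a)} (\<lambda>t. w t / t)) {1..b / a}"
    proof (rule has_integral_substitution[where c = a and d = b])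
      show "(*) a ` {1..b / a} \<subseteq> {a..b}" using a by (auto simp: field_simps)
    qed (use a that in \<open>auto intro!: continuous_intros wS derivative_eq_intros simp: field_simps\<close>)
    thus ?thesis using a by (simp add: integral_unique)
  qed
  have "continuous_on UNIV (\<lambda>x. w (a * x))"
    by (rule continuous_on_compose2[OF w]) (auto intro!: continuous_intros)
  then have "((\<lambda>T. integral {1..T} (\<lambda>t. w (a * t) / t))
       \<longlongrightarrow> - integral {0..1} (\<lambda>x. Digamma (1 + x) * w (a * x))) at_top"
    by (rule Digamma_unfold_at_top) (use per1 mean bound in \<open>auto simp: a_def\<close>)
  moreover have "filterlim (\<lambda>b. b / a) at_top at_top" using a by real_asymp
  ultimately have "((\<lambda>b. integral {1..b / a} (\<lambda>t. w (a * t) / t))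
       \<longlongrightarrow> - integral {0..1} (\<lambda>x. Digamma (1 + x) * w (a * x))) at_top"
    by (rule filterlim_compose)
  moreover have "\<forall>\<^sub>F b in at_top. integral {1..b / a} (\<lambda>u. w (a * u) / u) = integral {a..b} (\<lambda>t. w t / t)"
    using eventually_ge_at_top[of a] by eventually_elim (simp add: scale)
  ultimately show "((\<lambda>b. integral {2 * pi * real n..b} (\<lambda>t. w t / t))
       \<longlongrightarrow> - integral {0..1} (\<lambda>x. Digamma (1 + x) * w (2 * pi * real n * x))) at_top"
    unfolding a_def by (rule Lim_transform_eventually)
qed

section \<open>Fourier coefficients of the logarithm of the gamma function\<close>

lemma has_integral_trig_by_parts:
  fixes u u' :: "real \<Rightarrow> real"
  assumes u: "\<And>x. x \<in> {0..1} \<Longrightarrow> (u has_real_derivative u' x) (at x)"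
    and u': "continuous_on {0..1} u'" and c: "c \<noteq> 0"
  shows "((\<lambda>x. u x * cos (c * x)) has_integral
            (u 1 * sin c - integral {0..1} (\<lambda>x. u' x * sin (c * x))) / c) {0..1}"
    and "((\<lambda>x. u x * sin (c * x)) has_integral
            (u 0 - u 1 * cos c + integral {0..1} (\<lambda>x. u' x * cos (c * x))) / c) {0..1}"
proof -
  have d: "(u has_real_derivative u' x) (at x within {0..1})" if "x \<in> {0..1}" for x
    using u[OF that] by (rule DERIV_subset) simp
  have prod1: "((\<lambda>x. u' x * sin (c * x) + u x * cos (c * x) * c) has_integral
      u 1 * sin (c * 1) - u 0 * sin (c * 0)) {0..1}"
    by (rule fundamental_theorem_of_calculus)
       (auto intro!: derivative_eq_intros d simp: has_real_derivative_iff_has_vector_derivative[symmetric])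
  have int1: "((\<lambda>x. u' x * sin (c * x)) has_integral integral {0..1} (\<lambda>x. u' x * sin (c * x))) {0..1}"
    by (intro integrable_integral integrable_continuous_real continuous_intros u')
  have "((\<lambda>x. u x * cos (c * x) * c) has_integral
      u 1 * sin c - integral {0..1} (\<lambda>x. u' x * sin (c * x))) {0..1}"
    using has_integral_diff[OF prod1 int1] by simp
  from has_integral_divide[OF this, of c] c
  show "((\<lambda>x. u x * cos (c * x)) has_integral
            (u 1 * sin c - integral {0..1} (\<lambda>x. u' x * sin (c * x))) / c) {0..1}" by simp
  have prod2: "((\<lambda>x. u' x * cos (c * x) + u x * (- sin (c * x) * c)) has_integral
      u 1 * cos (c * 1) - u 0 * cos (c * 0)) {0..1}"
    by (rule fundamental_theorem_of_calculus)
       (auto intro!: derivative_eq_intros d simp: has_real_derivative_iff_has_vector_derivative[symmetric])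
  have int2: "((\<lambda>x. u' x * cos (c * x)) has_integral integral {0..1} (\<lambda>x. u' x * cos (c * x))) {0..1}"
    by (intro integrable_integral integrable_continuous_real continuous_intros u')
  have "((\<lambda>x. u x * sin (c * x) * c) has_integral
      integral {0..1} (\<lambda>x. u' x * cos (c * x)) - (u 1 * cos c - u 0)) {0..1}"
    using has_integral_diff[OF int2 prod2] by (simp add: mult.assoc)
  from has_integral_divide[OF this, of c] c
  show "((\<lambda>x. u x * sin (c * x)) has_integral
            (u 0 - u 1 * cos c + integral {0..1} (\<lambda>x. u' x * cos (c * x))) / c) {0..1}"
    by (simp add: algebra_simps)
qed

lemma has_real_derivative_Digamma_shift:
  assumes "x \<in> {0..1::real}"
  shows "((\<lambda>x. ln_Gamma (1 + x)) has_real_derivative Digamma (1 + x)) (at x)"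
    and "((\<lambda>x. Digamma (1 + x)) has_real_derivative Polygamma 1 (1 + x)) (at x)"
  using assms by (auto intro!: derivative_eq_intros elim!: nonpos_Ints_cases)

lemma continuous_on_Polygamma_shift: "continuous_on {0..1} (\<lambda>x::real. Polygamma n (1 + x))"
  by (intro continuous_at_imp_continuous_on ballI isCont_Polygamma) (auto elim!: nonpos_Ints_cases)

text \<open>
  The defining integrals of \<open>si\<close> and \<open>Ci\<close> converge only conditionally; at the
  points \<open>2 \<pi> n\<close> both their existence and their value come from unfolding the digamma
  function.
\<close>

lemma si_Ci_2pi_nat_eq_Digamma_integral:
  fixes n :: nat
  assumes n: "n > 0"
  shows "si (2 * pi * real n) = integral {0..1} (\<lambda>x. Digamma (1 + x) * sin (2 * pi * real n * x))"
    and "Ci (2 * pi * real n) = integral {0..1} (\<lambda>x. Digamma (1 + x) * cos (2 * pi * real n * x))"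
proof -
  have "((\<lambda>t. sin t / t) has_integral
      - integral {0..1} (\<lambda>x. Digamma (1 + x) * sin (2 * pi * real n * x))) {2 * pi * real n..}"
    using has_integral_trig_int(2)[of "int n"] n
    by (intro has_integral_oscillating_over_ray continuous_intros) auto
  thus "si (2 * pi * real n) = integral {0..1} (\<lambda>x. Digamma (1 + x) * sin (2 * pi * real n * x))"
    unfolding si_def by (simp add: integral_unique)
  have "((\<lambda>t. cos t / t) has_integral
      - integral {0..1} (\<lambda>x. Digamma (1 + x) * cos (2 * pi * real n * x))) {2 * pi * real n..}"
    using has_integral_trig_int(1)[of "int n"] n
    by (intro has_integral_oscillating_over_ray continuous_intros) auto
  thus "Ci (2 * pi * real n) = integral {0..1} (\<lambda>x. Digamma (1 + x) * cos (2 * pi * real n * x))"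
    unfolding Ci_def by (simp add: integral_unique)
qed

lemma sin_cos_2pi_nat: "sin (2 * pi * real n) = 0" "cos (2 * pi * real n) = 1"
  using sin_cos_2pi_int[of "int n"] by simp_all

lemma ln_Gamma_1_2: "ln_Gamma (1::real) = 0" "ln_Gamma (2::real) = 0"
  using Gamma_numeral[of "num.Bit0 num.One"] by (simp_all add: ln_Gamma_real_pos)

text \<open>
  Integration by parts reduces to the digamma function. There is no boundary term because
  \<open>ln_Gamma\<close> vanishes at both \<open>1\<close> and \<open>2\<close>.
\<close>

lemma ln_Gamma_fourier_coefficients:
  fixes n :: nat
  assumes n: "n > 0"
  shows "((\<lambda>x. ln_Gamma (1 + x) * cos (2 * pi * real n * x)) has_integral
            - si (2 * pi * real n) / (2 * pi * real n)) {0..1}"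
    and "((\<lambda>x. ln_Gamma (1 + x) * sin (2 * pi * real n * x)) has_integral
            Ci (2 * pi * real n) / (2 * pi * real n)) {0..1}"
  using has_integral_trig_by_parts[OF has_real_derivative_Digamma_shift(1) continuous_on_Polygamma_shift[of 0],
      of "2 * pi * real n"] n
  by (simp_all add: ln_Gamma_1_2 si_Ci_2pi_nat_eq_Digamma_integral)

text \<open>
  A second integration by parts, now in the integral of the digamma function. The Fourier
  coefficients of \<open>ln_Gamma (1 + x)\<close> thereby become \<open>O(1 / n\<^sup>2)\<close>.
\<close>

lemma si_Ci_2pi_nat_decay:
  obtains K where "\<And>n. n > 0 \<Longrightarrow> \<bar>si (2 * pi * real n)\<bar> \<le> K / real n"
    and "\<And>n. n > 0 \<Longrightarrow> \<bar>Ci (2 * pi * real n)\<bar> \<le> K / real n"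
proof -
  obtain B where B: "\<And>x. x \<in> {0..1} \<Longrightarrow> \<bar>Polygamma 1 (1 + x) :: real\<bar> \<le> B"
    using compact_continuous_image[OF continuous_on_Polygamma_shift[of 1]] compact_imp_bounded bounded_iff
    by (metis (no_types, lifting) compact_Icc imageI real_norm_def)
  define K where "K = \<bar>Digamma 1 - Digamma 2\<bar> + B"
  have int_bound: "\<bar>integral {0..1} (\<lambda>x. Polygamma 1 (1 + x) * w x)\<bar> \<le> B"
    if "continuous_on {0..1} w" "\<And>x. \<bar>w x\<bar> \<le> 1" for w :: "real \<Rightarrow> real"
  proof -
    have "norm (integral {0..1} (\<lambda>x. Polygamma 1 (1 + x) * w x)) \<le> B * (1 - 0)"
    proof (rule integral_bound)
      show "continuous_on {0..1} (\<lambda>x. Polygamma 1 (1 + x) * w x)"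
        by (intro continuous_intros continuous_on_Polygamma_shift that)
      show "norm (Polygamma 1 (1 + x) * w x) \<le> B" if "x \<in> {0..1}" for x
        using mult_mono[OF B[OF that] \<open>\<And>x. \<bar>w x\<bar> \<le> 1\<close>[of x]] B[OF that] by (auto simp: abs_mult)
    qed simp
    thus ?thesis by simp
  qed
  have B0: "B \<ge> 0" using B[of 0] by simp
  note parts = has_integral_trig_by_parts[OF has_real_derivative_Digamma_shift(2)
      continuous_on_Polygamma_shift[of 1], THEN integral_unique]
  have shrink: "\<bar>z / (2 * pi * real n)\<bar> \<le> K / real n" if "\<bar>z\<bar> \<le> K" "n > 0" for z and n :: nat
  proof -
    have "real n \<le> 2 * pi * real n" using pi_ge_two that by simp
    thus ?thesis using that by (auto simp: abs_mult intro!: frac_le)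
  qed
  show ?thesis
  proof (rule that)
    fix n :: nat assume n: "n > 0"
    have "\<bar>Digamma 1 - Digamma 2 + integral {0..1} (\<lambda>x. Polygamma 1 (1 + x) * cos (2 * pi * real n * x))\<bar> \<le> K"
      unfolding K_def by (rule order_trans[OF abs_triangle_ineq], intro add_left_mono int_bound)
        (auto intro!: continuous_intros)
    thus "\<bar>si (2 * pi * real n)\<bar> \<le> K / real n"
      using shrink[OF _ n] parts(2)[of "2 * pi * real n"] n
      by (simp add: si_Ci_2pi_nat_eq_Digamma_integral sin_cos_2pi_nat)
    have "\<bar>- integral {0..1} (\<lambda>x. Polygamma 1 (1 + x) * sin (2 * pi * real n * x))\<bar> \<le> K"
      unfolding K_def abs_minus_cancel by (rule order_trans[OF int_bound]) (auto intro!: continuous_intros)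
    thus "\<bar>Ci (2 * pi * real n)\<bar> \<le> K / real n"
      using shrink[OF _ n] parts(1)[of "2 * pi * real n"] n
      by (simp add: si_Ci_2pi_nat_eq_Digamma_integral sin_cos_2pi_nat)
  qed
qed

section \<open>Mean value of the logarithm of the gamma function\<close>

text \<open>
  Legendre's formula at \<open>x + 1 / 2\<close>, arranged such that only arguments \<open>\<ge> 1\<close> of
  \<open>ln_Gamma\<close> occur and the identity still holds at \<open>x = 0\<close>.
\<close>

lemma ln_Gamma_duplication:
  fixes x :: real
  assumes x: "x \<ge> 0"
  shows "ln_Gamma (1 + x) + ln_Gamma (1 + (x + 1/2))
       = ln_Gamma (1 + 2 * x) + (ln (x + 1/2) - 2 * x * ln 2 + ln pi / 2)"
proof -
  have nz: "complex_of_real t \<notin> \<int>\<^sub>\<le>\<^sub>0" if "t > 0" for t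
    using that by (auto elim!: nonpos_Ints_cases simp: complex_eq_iff)
  have "Gamma (complex_of_real (x + 1/2)) * Gamma (complex_of_real (x + 1/2) + 1/2)
      = exp ((1 - 2 * complex_of_real (x + 1/2)) * of_real (ln 2)) * of_real (sqrt pi)
          * Gamma (2 * complex_of_real (x + 1/2))"
    using nz[of "x + 1/2"] nz[of "x + 1"] x by (intro Gamma_legendre_duplication) (simp_all add: add.assoc)
  also have "complex_of_real (x + 1/2) + 1/2 = of_real (1 + x)" by simp
  also have "2 * complex_of_real (x + 1/2) = of_real (1 + 2 * x)" by simp
  also have "(1 - complex_of_real (1 + 2 * x)) * of_real (ln 2) = of_real (- (2 * x * ln 2))" by simp
  finally have "of_real (Gamma (x + 1/2) * Gamma (1 + x))
      = complex_of_real (exp (- (2 * x * ln 2)) * sqrt pi * Gamma (1 + 2 * x))"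
    by (simp only: Gamma_complex_of_real exp_of_real of_real_mult)
  then have dup: "Gamma (x + 1/2) * Gamma (1 + x) = exp (- (2 * x * ln 2)) * sqrt pi * Gamma (1 + 2 * x)"
    by (simp only: of_real_eq_iff)
  have "Gamma (1 + (x + 1/2)) = (x + 1/2) * Gamma (x + 1/2)"
  proof -
    have "x + 1/2 \<notin> \<int>\<^sub>\<le>\<^sub>0" using x by (auto dest: nonpos_Ints_nonpos)
    from Gamma_plus1[OF this] show ?thesis by (simp add: add_ac)
  qed
  then have "Gamma (1 + x) * Gamma (1 + (x + 1/2))
      = (x + 1/2) * (exp (- (2 * x * ln 2)) * sqrt pi * Gamma (1 + 2 * x))"
    using dup by (simp add: mult_ac)
  then have "ln (Gamma (1 + x) * Gamma (1 + (x + 1/2)))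
      = ln ((x + 1/2) * (exp (- (2 * x * ln 2)) * sqrt pi * Gamma (1 + 2 * x)))" by simp
  thus ?thesis using x by (simp add: ln_Gamma_real_pos ln_mult_pos ln_sqrt Gamma_real_pos)
qed

text \<open>
  Integrate the duplication formula over \<open>{0..1/2}\<close>: the left side gives the full integral
  \<open>I\<close>, the right side \<open>I / 2\<close> and an elementary integral, and the resulting linear equation
  determines \<open>I\<close>.
\<close>

lemma integral_ln_Gamma_shift:
  "((\<lambda>x. ln_Gamma (1 + x)) has_integral 1 / 2 * ln (2 * pi) - 1) {0..1::real}"
proof -
  define F where "F x = ln_Gamma (1 + x)" for x :: real
  have F_cont: "continuous_on {0..1} F"
    unfolding F_def using has_real_derivative_Digamma_shift(1)
    by (intro continuous_at_imp_continuous_on ballI DERIV_isCont)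
  have F_cont': "continuous_on {0..1/2} F" by (rule continuous_on_subset[OF F_cont]) auto
  define I where "I = integral {0..1} F"
  have "((\<lambda>x. 1 *\<^sub>R F (x + 1/2)) has_integral integral {0 + 1/2..1/2 + 1/2} F) {0..1/2}"
    by (rule has_integral_substitution[where c = 0 and d = 1])
       (auto intro!: derivative_eq_intros F_cont)
  then have 1: "((\<lambda>x. F (x + 1/2)) has_integral integral {1/2..1} F) {0..1/2}" by simp
  have "((\<lambda>x. 2 *\<^sub>R F (2 * x)) has_integral integral {2 * 0..2 * (1/2)} F) {0..1/2}"
    by (rule has_integral_substitution[where c = 0 and d = 1])
       (auto intro!: derivative_eq_intros F_cont)
  from has_integral_divide[OF this, of 2] have 2: "((\<lambda>x. F (2 * x)) has_integral I / 2) {0..1/2}"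
    by (simp add: I_def)
  have 3: "((\<lambda>x. ln (x + 1/2) - 2 * x * ln 2 + ln pi / 2) has_integral
      ((1/2 + 1/2) * ln (1/2 + 1/2) - 1/2 - (1/2)^2 * ln 2 + 1/2 * ln pi / 2)
      - ((0 + 1/2) * ln (0 + 1/2) - 0 - 0^2 * ln 2 + 0 * ln pi / 2)) {0..1/2::real}"
    by (rule fundamental_theorem_of_calculus)
       (auto intro!: derivative_eq_intros simp: has_real_derivative_iff_has_vector_derivative[symmetric])
  have "(F has_integral integral {0..1/2} F) {0..1/2}"
    using F_cont' by (intro integrable_integral integrable_continuous_real)
  from has_integral_add[OF this 1]
  have "((\<lambda>x. F (2 * x) + (ln (x + 1/2) - 2 * x * ln 2 + ln pi / 2)) has_integral
      integral {0..1/2} F + integral {1/2..1} F) {0..1/2}"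
  proof (rule has_integral_eq[rotated])
    show "F x + F (x + 1/2) = F (2 * x) + (ln (x + 1/2) - 2 * x * ln 2 + ln pi / 2)"
      if "x \<in> {0..1/2}" for x
      using ln_Gamma_duplication[of x] that unfolding F_def by simp
  qed
  moreover have "integral {0..1/2} F + integral {1/2..1} F = I"
    unfolding I_def by (rule Henstock_Kurzweil_Integration.integral_combine)
      (auto intro!: integrable_continuous_real F_cont)
  ultimately have "I = I / 2 + (((1/2 + 1/2) * ln (1/2 + 1/2) - 1/2 - (1/2)^2 * ln 2 + 1/2 * ln pi / 2)
      - ((0 + 1/2) * ln (0 + 1/2) - 0 - 0^2 * ln 2 + 0 * ln pi / 2))"
    using has_integral_unique[OF _ has_integral_add[OF 2 3]] by simp
  also have "\<dots> = I / 2 + (ln 2 / 4 + ln pi / 4 - 1/2)"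
    by (simp add: ln_div power2_eq_square)
  finally have "I = 1 / 2 * ln (2 * pi) - 1"
    using ln_mult[of 2 pi] by (simp add: field_simps)
  moreover have "(F has_integral I) {0..1}"
    unfolding I_def using F_cont by (intro integrable_integral integrable_continuous_real)
  ultimately show ?thesis by (simp add: F_def[abs_def])
qed

section \<open>Elementary integrals against the cosine\<close>

text \<open>
  An antiderivative is \<open>(ln x * sin (c * x) - Si (c * x)) / c\<close>, which extends continuously to
  \<open>0\<close>; with the convention \<open>ln 0 = 0\<close> the formula itself gives the extension.
\<close>

lemma has_integral_ln_cos:
  assumes c: "c \<noteq> 0"
  shows "((\<lambda>x. ln x * cos (c * x)) has_integral - Si c / c) {0..1::real}"
proof -
  have Si0: "Si 0 = 0" by (simp add: Si_def zero_ereal_def[symmetric])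
  have "((\<lambda>x::real. x * ln x) \<longlongrightarrow> 0) (at_right 0)" by real_asymp
  from tendsto_mult_right_zero[OF tendsto_rabs_zero[OF this], of "\<bar>c\<bar>"]
  have majorant: "((\<lambda>x::real. \<bar>c\<bar> * \<bar>x * ln x\<bar>) \<longlongrightarrow> 0) (at_right 0)" .
  have "norm (ln x * sin (c * x)) \<le> \<bar>c\<bar> * \<bar>x * ln x\<bar>" for x
    using mult_left_mono[OF abs_sin_x_le_abs_x[of "c * x"], of "\<bar>ln x\<bar>"] by (simp add: abs_mult mult_ac)
  then have lim0: "((\<lambda>x. ln x * sin (c * x)) \<longlongrightarrow> 0) (at_right 0)"
    by (intro Lim_null_comparison[OF always_eventually majorant] allI)
  have "continuous (at x within {0..1}) (\<lambda>x. ln x * sin (c * x))" if "x \<in> {0..1}" for x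
  proof (cases "x = 0")
    case True
    thus ?thesis using lim0 by (simp add: continuous_within at_within_Icc_at_right)
  next
    case False
    have "isCont (\<lambda>x. sin (c * x)) x" by (intro continuous_intros)
    from isCont_mult[OF isCont_ln[OF False] this] show ?thesis
      by (rule continuous_at_imp_continuous_at_within)
  qed
  then have cont: "continuous_on {0..1} (\<lambda>x. ln x * sin (c * x))"
    by (simp add: continuous_on_eq_continuous_within)
  have Si_cont: "continuous_on {0..1} (\<lambda>x. Si (c * x))"
  proof (rule continuous_on_compose2[of UNIV Si])
    show "continuous_on UNIV Si" by (simp add: continuous_at_imp_continuous_on isCont_Si)
    show "continuous_on {0..1} (\<lambda>x. c * x)" by (intro continuous_intros)
  qed simp
  have "((\<lambda>x. ln x * cos (c * x)) has_integral
      (ln 1 * sin (c * 1) / c - Si (c * 1) / c) - (ln 0 * sin (c * 0) / c - Si (c * 0) / c)) {0..1}"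
  proof (rule fundamental_theorem_of_calculus_interior)
    show "continuous_on {0..1} (\<lambda>x. ln x * sin (c * x) / c - Si (c * x) / c)"
      using c by (intro continuous_intros cont Si_cont) auto
    show "((\<lambda>x. ln x * sin (c * x) / c - Si (c * x) / c) has_vector_derivative ln x * cos (c * x)) (at x)"
      if "x \<in> {0<..<1}" for x
      using that c
      by (auto intro!: derivative_eq_intros DERIV_chain2[OF DERIV_Si]
          simp: has_real_derivative_iff_has_vector_derivative[symmetric] field_simps)
  qed simp
  thus ?thesis by (simp add: Si0)
qed

text \<open>
  With \<open>u = 2 m + p\<close> and \<open>v = 2 m - p\<close> the products become sums of functions of
  frequencies \<open>u\<close> and \<open>v\<close>, and the denominator is \<open>u * v\<close>.
\<close>

lemma integral_trig_2pi_nat_times_cos: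
  fixes m :: nat and p :: real
  assumes p: "p \<noteq> 2 * real m" "p \<noteq> - 2 * real m"
  shows "integral {0..1} (\<lambda>x. cos (2 * pi * real m * x) * cos (p * pi * x))
           = - (p * sin (p * pi) / pi) / (4 * (real m)\<^sup>2 - p\<^sup>2)" (is ?th1)
    and "integral {0..1} (\<lambda>x. sin (2 * pi * real m * x) * cos (p * pi * x))
           = 2 * real m * (1 - cos (p * pi)) / pi / (4 * (real m)\<^sup>2 - p\<^sup>2)" (is ?th2)
proof -
  define u v where "u = 2 * real m + p" and "v = 2 * real m - p"
  have nz: "u \<noteq> 0" "v \<noteq> 0" using p by (auto simp: u_def v_def)
  have prod: "4 * (real m)\<^sup>2 - p\<^sup>2 = u * v" by (simp add: u_def v_def power2_eq_square algebra_simps)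
  have ang: "u * pi = 2 * pi * real m + p * pi" "v * pi = 2 * pi * real m - p * pi"
    by (simp_all add: u_def v_def algebra_simps)
  have ang': "u * pi * x = 2 * pi * real m * x + p * pi * x"
    "v * pi * x = 2 * pi * real m * x - p * pi * x" for x
    by (simp_all add: u_def v_def algebra_simps)
  have sc: "sin (u * pi) = sin (p * pi)" "sin (v * pi) = - sin (p * pi)"
    "cos (u * pi) = cos (p * pi)" "cos (v * pi) = cos (p * pi)"
    by (simp_all only: ang sin_add sin_diff cos_add cos_diff sin_cos_2pi_nat)
  have "((\<lambda>x. 1/2 * (cos (u * pi * x) + cos (v * pi * x))) has_integral
      1/2 * (sin (p * pi) / (u * pi) + - sin (p * pi) / (v * pi))) {0..1}"
    using has_integral_mult_right[OF has_integral_add[OF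
        has_integral_cos_Icc01[of "u * pi"] has_integral_cos_Icc01[of "v * pi"]], of "1/2"] nz
    by (simp add: sc)
  moreover have "(\<lambda>x. 1/2 * (cos (u * pi * x) + cos (v * pi * x)))
      = (\<lambda>x. cos (2 * pi * real m * x) * cos (p * pi * x))"
    by (simp only: ang' cos_add cos_diff) (simp add: mult.commute)
  moreover have "1/2 * (sin (p * pi) / (u * pi) + - sin (p * pi) / (v * pi))
      = - (p * sin (p * pi) / pi) / (u * v)"
  proof -
    have "sin (p * pi) / (u * pi) + - sin (p * pi) / (v * pi) = (v - u) * sin (p * pi) / (u * v * pi)"
      using nz by (simp add: field_simps)
    also have "v - u = - 2 * p" by (simp add: u_def v_def)
    finally show ?thesis by (simp add: mult_ac)
  qed
  ultimately show ?th1 unfolding prod by (metis integral_unique)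
  have "((\<lambda>x. 1/2 * (sin (u * pi * x) + sin (v * pi * x))) has_integral
      1/2 * ((1 - cos (p * pi)) / (u * pi) + (1 - cos (p * pi)) / (v * pi))) {0..1}"
    using has_integral_mult_right[OF has_integral_add[OF
        has_integral_sin_Icc01[of "u * pi"] has_integral_sin_Icc01[of "v * pi"]], of "1/2"] nz
    by (simp add: sc)
  moreover have "(\<lambda>x. 1/2 * (sin (u * pi * x) + sin (v * pi * x)))
      = (\<lambda>x. sin (2 * pi * real m * x) * cos (p * pi * x))"
    by (simp only: ang' sin_add sin_diff) (simp add: mult.commute)
  moreover have "1/2 * ((1 - cos (p * pi)) / (u * pi) + (1 - cos (p * pi)) / (v * pi))
      = 2 * real m * (1 - cos (p * pi)) / pi / (u * v)"
  proof -
    have "(1 - cos (p * pi)) / (u * pi) + (1 - cos (p * pi)) / (v * pi)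
        = (u + v) * (1 - cos (p * pi)) / (u * v * pi)"
      using nz by (simp add: field_simps)
    also have "u + v = 4 * real m" by (simp add: u_def v_def)
    finally show ?thesis using nz by (simp add: field_simps)
  qed
  ultimately show ?th2 unfolding prod by (metis integral_unique)
qed

lemma summable_bounded_over_square_diff:
  fixes c :: "nat \<Rightarrow> real"
  assumes c: "\<And>n. \<bar>c n\<bar> \<le> K"
  shows "summable (\<lambda>n. c n / (4 * (real (Suc n))\<^sup>2 - p\<^sup>2))"
proof (rule summable_comparison_test_ev)
  show "summable (\<lambda>n. K * inverse (real (Suc n) ^ 2))"
    using inverse_power_summable[of 2, where 'a = real]
    by (intro summable_mult, subst summable_Suc_iff) simp
  have "\<forall>\<^sub>F n in sequentially. (real (Suc n))\<^sup>2 \<le> 4 * (real (Suc n))\<^sup>2 - p\<^sup>2"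
    by real_asymp
  thus "\<forall>\<^sub>F n in sequentially. norm (c n / (4 * (real (Suc n))\<^sup>2 - p\<^sup>2)) \<le> K * inverse (real (Suc n) ^ 2)"
  proof eventually_elim
    case (elim n)
    have "(real (Suc n))\<^sup>2 > 0" by simp
    with elim have "\<bar>c n\<bar> / (4 * (real (Suc n))\<^sup>2 - p\<^sup>2) \<le> K / (real (Suc n))\<^sup>2"
      using c[of n] by (intro frac_le) (auto intro: order_trans[OF abs_ge_zero])
    moreover have "4 * (real (Suc n))\<^sup>2 - p\<^sup>2 > 0" using elim \<open>(real (Suc n))\<^sup>2 > 0\<close> by linarith
    ultimately show ?case by (simp add: divide_inverse abs_mult)
  qed
qed

section \<open>The cosine transform of the logarithm of the gamma function\<close>

theorem mainTheorem3:
  fixes p :: real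
  assumes "\<not> (\<exists>k::int. p = 2 * of_int k)"
  shows "summable (\<lambda>n. Ci (2 * real (Suc n) * pi) / (4 * (real (Suc n))\<^sup>2 - p\<^sup>2))
    \<and> summable (\<lambda>n. 1 / real (Suc n) * (si (2 * real (Suc n) * pi) / (4 * (real (Suc n))\<^sup>2 - p\<^sup>2)))
    \<and> ((\<lambda>x. ln (Gamma x) * cos (p * pi * x)) has_integral
           (1 / 2 * ln (2 * pi) - 1) * (sin (p * pi) / (p * pi))
           + Si (p * pi) / (p * pi)
           + 2 * (1 - cos (p * pi)) / pi\<^sup>2
               * (\<Sum>n. Ci (2 * real (Suc n) * pi) / (4 * (real (Suc n))\<^sup>2 - p\<^sup>2))
           + p * sin (p * pi) / pi\<^sup>2
               * (\<Sum>n. 1 / real (Suc n) * (si (2 * real (Suc n) * pi) / (4 * (real (Suc n))\<^sup>2 - p\<^sup>2))))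
         {0..1}"
proof -
  define s c where "s = sin (p * pi)" and "c = cos (p * pi)"
  define q where "q n = 4 * (real (Suc n))\<^sup>2 - p\<^sup>2" for n
  define S where "S n = si (2 * real (Suc n) * pi)" for n
  define C where "C n = Ci (2 * real (Suc n) * pi)" for n
  have p: "p \<noteq> 2 * real_of_int k" for k using assms by blast
  have p0: "p * pi \<noteq> 0" using p[of 0] by simp
  have two_pi: "2 * real (Suc n) * pi = 2 * pi * real (Suc n)" for n by simp
  obtain K where K: "\<And>n. n > 0 \<Longrightarrow> \<bar>si (2 * pi * real n)\<bar> \<le> K / real n"
    "\<And>n. n > 0 \<Longrightarrow> \<bar>Ci (2 * pi * real n)\<bar> \<le> K / real n"
    using si_Ci_2pi_nat_decay by blast
  have decay: "\<bar>S n\<bar> \<le> K / real (Suc n)" "\<bar>C n\<bar> \<le> K / real (Suc n)" for n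
    unfolding S_def C_def two_pi by (rule K; simp)+
  have K0: "K \<ge> 0" using decay(1)[of 0] by simp
  have K_le: "K / real (Suc n) \<le> K" for n
    using K0 by (simp add: field_simps)
  have C_sum: "summable (\<lambda>n. C n / q n)"
    unfolding q_def by (rule summable_bounded_over_square_diff[where K = K])
      (rule order_trans[OF decay(2) K_le])
  have S_sum: "summable (\<lambda>n. 1 / real (Suc n) * (S n / q n))"
  proof -
    have "summable (\<lambda>n. (S n / real (Suc n)) / q n)"
      unfolding q_def
    proof (rule summable_bounded_over_square_diff[where K = K])
      fix n
      have "\<bar>S n\<bar> / real (Suc n) \<le> \<bar>S n\<bar> / 1" by (intro frac_le) auto
      also have "\<dots> \<le> K" using order_trans[OF decay(1) K_le, of n] by simp
      finally show "\<bar>S n / real (Suc n)\<bar> \<le> K" by simp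
    qed
    thus ?thesis by (simp only: divide_inverse mult_ac mult_1_left)
  qed
  define a b where "a n = - S n / (2 * pi * real (Suc n))"
    and "b n = C n / (2 * pi * real (Suc n))" for n
  have coeff_summable: "summable (\<lambda>n. \<bar>z n / (2 * pi * real (Suc n))\<bar>)"
    if "\<And>n. \<bar>z n\<bar> \<le> K / real (Suc n)" for z
  proof (rule summable_comparison_test)
    have "summable (\<lambda>n. inverse (real (Suc n) ^ 2))"
      using inverse_power_summable[of 2, where 'a = real] by (subst summable_Suc_iff) simp
    thus "summable (\<lambda>n. K / (2 * pi) * inverse (real (Suc n) ^ 2))" by (rule summable_mult)
    show "\<exists>N. \<forall>n\<ge>N. norm \<bar>z n / (2 * pi * real (Suc n))\<bar> \<le> K / (2 * pi) * inverse (real (Suc n) ^ 2)"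
    proof (intro exI allI impI)
      fix n
      have "norm \<bar>z n / (2 * pi * real (Suc n))\<bar> = \<bar>z n\<bar> / (2 * pi * real (Suc n))"
        by (simp add: abs_mult)
      also have "\<dots> \<le> K / real (Suc n) / (2 * pi * real (Suc n))"
        using that[of n] by (intro divide_right_mono) auto
      also have "\<dots> = K / (2 * pi) * inverse (real (Suc n) ^ 2)"
        by (simp only: power2_eq_square divide_inverse inverse_mult_distrib mult_ac)
      finally show "norm \<bar>z n / (2 * pi * real (Suc n))\<bar> \<le> K / (2 * pi) * inverse (real (Suc n) ^ 2)" .
    qed
  qed
  define F where "F x = ln_Gamma (1 + x)" for x :: real
  have F_cont: "continuous_on {0..1} F"
    unfolding F_def using has_real_derivative_Digamma_shift(1)
    by (intro continuous_at_imp_continuous_on ballI DERIV_isCont)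
  have cos_cont: "continuous_on {0..1} (\<lambda>x. cos (p * pi * x))" by (intro continuous_intros)
  have "(\<lambda>n. 2 * (a n * integral {0..1} (\<lambda>x. cos (2 * pi * real (Suc n) * x) * cos (p * pi * x))
               + b n * integral {0..1} (\<lambda>x. sin (2 * pi * real (Suc n) * x) * cos (p * pi * x))))
      sums (integral {0..1} (\<lambda>x. F x * cos (p * pi * x))
            - (1 / 2 * ln (2 * pi) - 1) * integral {0..1} (\<lambda>x. cos (p * pi * x)))"
  proof (rule fourier_series_sums_integral[OF F_cont _ cos_cont])
    show "F 0 = F 1" by (simp add: F_def ln_Gamma_1_2)
    show "(F has_integral 1 / 2 * ln (2 * pi) - 1) {0..1}"
      unfolding F_def[abs_def] by (rule integral_ln_Gamma_shift)
    show "((\<lambda>x. F x * cos (2 * pi * real (Suc n) * x)) has_integral a n) {0..1}"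
      "((\<lambda>x. F x * sin (2 * pi * real (Suc n) * x)) has_integral b n) {0..1}" for n
      unfolding F_def a_def b_def S_def C_def two_pi
      by (rule ln_Gamma_fourier_coefficients; simp)+
    show "summable (\<lambda>n. \<bar>a n\<bar>)"
      unfolding a_def by (rule coeff_summable) (simp only: abs_minus_cancel decay)
    show "summable (\<lambda>n. \<bar>b n\<bar>)"
      unfolding b_def by (rule coeff_summable) (rule decay)
  qed
  moreover have "2 * (a n * integral {0..1} (\<lambda>x. cos (2 * pi * real (Suc n) * x) * cos (p * pi * x))
               + b n * integral {0..1} (\<lambda>x. sin (2 * pi * real (Suc n) * x) * cos (p * pi * x)))
      = 2 * (1 - c) / pi\<^sup>2 * (C n / q n) + p * s / pi\<^sup>2 * (1 / real (Suc n) * (S n / q n))" for n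
  proof -
    have pn: "p \<noteq> 2 * real (Suc n)" "p \<noteq> - 2 * real (Suc n)"
      using p[of "int (Suc n)"] p[of "- int (Suc n)"] by simp_all
    note ints = integral_trig_2pi_nat_times_cos[OF pn, folded q_def s_def c_def]
    from pn have "q n \<noteq> 0"
      using power2_eq_iff[of "2 * real (Suc n)" p] by (auto simp: q_def power_mult_distrib simp del: of_nat_Suc)
    moreover have "real (Suc n) \<noteq> 0" by simp
    ultimately show ?thesis
      unfolding ints a_def b_def using pi_neq_zero
      by (simp add: field_simps power2_eq_square del: of_nat_Suc)
  qed
  moreover have "(\<lambda>n. 2 * (1 - c) / pi\<^sup>2 * (C n / q n) + p * s / pi\<^sup>2 * (1 / real (Suc n) * (S n / q n)))
      sums (2 * (1 - c) / pi\<^sup>2 * (\<Sum>n. C n / q n)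
          + p * s / pi\<^sup>2 * (\<Sum>n. 1 / real (Suc n) * (S n / q n)))"
    by (intro sums_add sums_mult summable_sums C_sum S_sum)
  moreover have "integral {0..1} (\<lambda>x. cos (p * pi * x)) = s / (p * pi)"
    using has_integral_cos_Icc01[of "p * pi"] p0 by (auto simp: s_def intro: integral_unique)
  ultimately have "integral {0..1} (\<lambda>x. F x * cos (p * pi * x)) - (1 / 2 * ln (2 * pi) - 1) * (s / (p * pi))
      = 2 * (1 - c) / pi\<^sup>2 * (\<Sum>n. C n / q n) + p * s / pi\<^sup>2 * (\<Sum>n. 1 / real (Suc n) * (S n / q n))"
    by (simp only: sums_unique2)
  then have F_val: "integral {0..1} (\<lambda>x. F x * cos (p * pi * x)) = (1 / 2 * ln (2 * pi) - 1) * (s / (p * pi))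
      + 2 * (1 - c) / pi\<^sup>2 * (\<Sum>n. C n / q n) + p * s / pi\<^sup>2 * (\<Sum>n. 1 / real (Suc n) * (S n / q n))"
    by linarith
  have "((\<lambda>x. F x * cos (p * pi * x)) has_integral integral {0..1} (\<lambda>x. F x * cos (p * pi * x))) {0..1}"
    by (intro integrable_integral integrable_continuous_real continuous_on_mult F_cont cos_cont)
  \<comment> \<open>the logarithmic singularity at \<open>0\<close> is put back: \<open>ln (Gamma x) = F x - ln x\<close> except at \<open>x = 0\<close>\<close>
  from has_integral_diff[OF this has_integral_ln_cos[OF p0]]
  have "((\<lambda>x. F x * cos (p * pi * x) - ln x * cos (p * pi * x)) has_integral
      (1 / 2 * ln (2 * pi) - 1) * (s / (p * pi)) + Si (p * pi) / (p * pi)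
      + 2 * (1 - c) / pi\<^sup>2 * (\<Sum>n. C n / q n)
      + p * s / pi\<^sup>2 * (\<Sum>n. 1 / real (Suc n) * (S n / q n))) {0..1}"
    unfolding F_val by (simp add: algebra_simps)
  then have "((\<lambda>x. ln (Gamma x) * cos (p * pi * x)) has_integral
      (1 / 2 * ln (2 * pi) - 1) * (s / (p * pi)) + Si (p * pi) / (p * pi)
      + 2 * (1 - c) / pi\<^sup>2 * (\<Sum>n. C n / q n)
      + p * s / pi\<^sup>2 * (\<Sum>n. 1 / real (Suc n) * (S n / q n))) {0..1}"
  proof (rule has_integral_spike_finite[of "{0}", rotated 2])
    fix x :: real assume x: "x \<in> {0..1} - {0}"
    then have "x \<notin> \<int>\<^sub>\<le>\<^sub>0" by (auto dest: nonpos_Ints_nonpos)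
    then have "Gamma (1 + x) = x * Gamma x" using Gamma_plus1[of x] by (simp add: add.commute)
    then have "F x = ln x + ln (Gamma x)"
      using x by (simp add: F_def ln_Gamma_real_pos ln_mult_pos Gamma_real_pos)
    thus "ln (Gamma x) * cos (p * pi * x) = F x * cos (p * pi * x) - ln x * cos (p * pi * x)"
      by (simp add: algebra_simps)
  qed simp
  with C_sum S_sum show ?thesis unfolding s_def c_def q_def S_def C_def by blast
qed

end
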